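(* Let $0<\mu\le Q$, $\kappa=\lfloor Q/\mu\rfloor$ and $\alpha=Q/(\mu\kappa)$. Let all customers be colocated at a point $x^*\in\mathbb{R}^2$ with $\|x^*\|>0$, so that $X_i=x^*$ with probability one and $\bar d=\|x^*\|$. Under each policy $\pi\in\{\text{DTD},\text{OR}\}$: (i) under deterministic demands $\xi_i=\mu$, $$\lim_{n\to\infty}\frac{V^{E,\pi}_n(X)}{n}=\alpha\cdot\frac{2\mu\bar d}{Q}\qquad\text{a.s.};$$ (ii) for every $\varepsilon\in(0,Q/\kappa]$, under i.i.d. demands $\xi_i\sim(Q+\varepsilon)\cdot\mathrm{Bern}\big(\mu/(Q+\varepsilon)\big)$, $$\lim_{n\to\infty}\frac{V^{E,\pi}_n(X)}{n}=\alpha\cdot\frac{2\mu\bar d}{Q}+\frac{2\mu\bar d}{Q+\varepsilon}\qquad\text{a.s.},$$ which approaches $(\alpha+1)\cdot2\mu\bar d/Q$ as $\varepsilon\downarrow0$.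
   Context: **Setting.** Customers $i\ge1$ have locations $X_i\in\mathbb{R}^2$ and i.i.d. non-negative demands $\xi_i$ with mean $\mu$, independent of locations; $Q>0$ is the vehicle capacity; $\bar d=\mathbb{E}\|X_i\|$ (Euclidean norm). The depot $0$ is at the origin $X_0$. Travel costs are $c_{i,j}=\|X_i-X_j\|$; failure cost $c^F_i=2\|X_i\|$; preventive return cost $c^P_{i,j}=\|X_i\|+\|X_j\|-\|X_i-X_j\|$ (no penalty terms; $c^P_{0,j}=0$). **Routes and recourse (conditional on locations; expectations below are over demands only).** A path is a nonempty sequence $p=(i_1,\dots,i_t)$ of distinct customers; with $i_0=i_{t+1}=0$, $L(p)=\sum_{j=0}^t\|X_{i_j}-X_{i_{j+1}}\|$. - DTD (detour-to-depot): $\bar{\mathcal{Q}}^{\text{DTD}}_p=\sum_{j=1}^t\sum_{l\ge1}\mathbb{P}\left[\sum_{k<j}\xi_{i_k}\le lQ<\sum_{k\le j}\xi_{i_k}\right]c^F_{i_j}$. - OR (optimal restocking): with $\Psi(s,q)=\max\{\lceil(s-q)/Q\rceil,0\}$ and $q\in[0,Q]$, set $F^p_{i_t}(q)=0$ and, for $j<t$, $F^p_{i_j}(q)=\min\{H^p_{i_{j+1}}(q),c^P_{i_j,i_{j+1}}+H^p_{i_{j+1}}(Q)\}$, where $H^p_i(q)=\mathbb{E}[c^F_i\Psi(\xi_i,q)+F^p_i(\Psi(\xi_i,q)Q+q-\xi_i)]$; $\bar{\mathcal{Q}}^{\text{OR}}_p=F^p_{i_0}(Q)$. $\mathcal{Q}^\pi_p$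 is the minimum of $\bar{\mathcal{Q}}^\pi$ over $p$ and its reversal. **Optimal value with expected capacity constraints.** $V^{E,\pi}_n(X)$ is the minimum, over all partitions of $\{1,\dots,n\}$ into any number of paths each containing at most $\kappa$ customers, of $\sum_p(L(p)+\mathcal{Q}^\pi_p)$. *)

theory Defs
  imports "HOL-Probability.Probability"
begin

text \<open>
  Index \<open>0\<close> is the depot, indices \<open>i \<ge> 1\<close> are the customers. The argument \<open>x\<close> below is a realization
  of the locations. Demands are random variables \<open>\<xi> i\<close> on \<open>M\<close>; all integrals and probabilities
  below are over the demands only, with \<open>x\<close> held fixed. As demands are independent of the locations,
  this is the conditional expectation given the locations.
\<close>

type_synonym location = "real^2"

datatype policy = DTD | OR

definition failure_cost :: "(nat \<Rightarrow> location) \<Rightarrow> nat \<Rightarrow> real" where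
  "failure_cost x i = 2 * norm (x i)"

definition return_cost :: "(nat \<Rightarrow> location) \<Rightarrow> nat \<Rightarrow> nat \<Rightarrow> real" where
  "return_cost x i j = norm (x i) + norm (x j) - norm (x i - x j)"

definition route_length :: "(nat \<Rightarrow> location) \<Rightarrow> nat list \<Rightarrow> real" where
  "route_length x p =
     (let r = 0 # p @ [0] in \<Sum>j\<le>length p. norm (x (r ! j) - x (r ! Suc j)))"

text \<open>Positions in the path are counted from \<open>0\<close>; the inner series runs over \<open>l \<ge> 1\<close>.\<close>

definition dtd_recourse ::
  "'a measure \<Rightarrow> (nat \<Rightarrow> 'a \<Rightarrow> real) \<Rightarrow> real \<Rightarrow> (nat \<Rightarrow> location) \<Rightarrow> nat list \<Rightarrow> real" where
  "dtd_recourse M \<xi> Q x p =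
     (\<Sum>j<length p. \<Sum>l.
        measure M {\<omega> \<in> space M. (\<Sum>k<j. \<xi> (p ! k) \<omega>) \<le> real (Suc l) * Q \<and>
                                real (Suc l) * Q < (\<Sum>k\<le>j. \<xi> (p ! k) \<omega>)}
        * failure_cost x (p ! j))"

definition refills :: "real \<Rightarrow> real \<Rightarrow> real \<Rightarrow> real" where
  "refills Q s q = real_of_int (max \<lceil>(s - q) / Q\<rceil> 0)"

text \<open>
  \<open>serve_cost M \<xi> Q x i G q\<close> is the expected cost \<open>H\<^sub>i(q)\<close> of serving customer \<open>i\<close> on arrival with
  load \<open>q\<close>, where \<open>G\<close> is the cost-to-go function after service. \<open>restock_cost M \<xi> Q x i p q\<close> is
  \<open>F\<^sub>i(q)\<close>, where \<open>p\<close> lists the customers that remain to be visited after \<open>i\<close>.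
\<close>

definition serve_cost ::
  "'a measure \<Rightarrow> (nat \<Rightarrow> 'a \<Rightarrow> real) \<Rightarrow> real \<Rightarrow> (nat \<Rightarrow> location) \<Rightarrow> nat \<Rightarrow> (real \<Rightarrow> real) \<Rightarrow> real \<Rightarrow> real"
  where
  "serve_cost M \<xi> Q x i G q =
     (\<integral>\<omega>. failure_cost x i * refills Q (\<xi> i \<omega>) q
          + G (refills Q (\<xi> i \<omega>) q * Q + q - \<xi> i \<omega>) \<partial>M)"

fun restock_cost ::
  "'a measure \<Rightarrow> (nat \<Rightarrow> 'a \<Rightarrow> real) \<Rightarrow> real \<Rightarrow> (nat \<Rightarrow> location) \<Rightarrow> nat \<Rightarrow> nat list \<Rightarrow> real \<Rightarrow> real"
  where
  "restock_cost M \<xi> Q x i [] = (\<lambda>q. 0)"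
| "restock_cost M \<xi> Q x i (j # p) =
     (let H = serve_cost M \<xi> Q x j (restock_cost M \<xi> Q x j p)
      in (\<lambda>q. min (H q) (return_cost x i j + H Q)))"

definition or_recourse ::
  "'a measure \<Rightarrow> (nat \<Rightarrow> 'a \<Rightarrow> real) \<Rightarrow> real \<Rightarrow> (nat \<Rightarrow> location) \<Rightarrow> nat list \<Rightarrow> real" where
  "or_recourse M \<xi> Q x p = restock_cost M \<xi> Q x 0 p Q"

fun directed_recourse ::
  "policy \<Rightarrow> 'a measure \<Rightarrow> (nat \<Rightarrow> 'a \<Rightarrow> real) \<Rightarrow> real \<Rightarrow> (nat \<Rightarrow> location) \<Rightarrow> nat list \<Rightarrow> real"
  where
  "directed_recourse DTD = dtd_recourse"
| "directed_recourse OR = or_recourse"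

definition recourse ::
  "policy \<Rightarrow> 'a measure \<Rightarrow> (nat \<Rightarrow> 'a \<Rightarrow> real) \<Rightarrow> real \<Rightarrow> (nat \<Rightarrow> location) \<Rightarrow> nat list \<Rightarrow> real"
  where
  "recourse \<pi> M \<xi> Q x p =
     min (directed_recourse \<pi> M \<xi> Q x p) (directed_recourse \<pi> M \<xi> Q x (rev p))"

text \<open>
  Partitions of \<open>{1..n}\<close> into paths with at most \<open>\<kappa>\<close> customers each. A set of lists suffices:
  two paths of a partition are nonempty and disjoint, so no path can be repeated.
\<close>

definition route_plans :: "nat \<Rightarrow> nat \<Rightarrow> nat list set set" where
  "route_plans \<kappa> n =
     {P. (\<forall>p\<in>P. p \<noteq> [] \<and> distinct p \<and> length p \<le> \<kappa>) \<and>
         disjoint_family_on set P \<and> (\<Union>p\<in>P. set p) = {1..n}}"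

definition opt_value ::
  "policy \<Rightarrow> 'a measure \<Rightarrow> (nat \<Rightarrow> 'a \<Rightarrow> real) \<Rightarrow> real \<Rightarrow> nat \<Rightarrow> (nat \<Rightarrow> location) \<Rightarrow> nat \<Rightarrow> real"
  where
  "opt_value \<pi> M \<xi> Q \<kappa> x n =
     Min ((\<lambda>P. \<Sum>p\<in>P. route_length x p + recourse \<pi> M \<xi> Q x p) ` route_plans \<kappa> n)"

text \<open>The minimum in \<^const>\<open>opt_value\<close> is over a finite nonempty set, and each plan is finite.\<close>

lemma finite_paths: "finite {p. distinct p \<and> set p \<subseteq> {1..n::nat}}"
proof (rule finite_subset)
  show "{p. distinct p \<and> set p \<subseteq> {1..n}} \<subseteq> {p. set p \<subseteq> {1..n} \<and> length p \<le> n}"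
    by (auto simp: distinct_card[symmetric] dest: card_mono[OF finite_atLeastAtMost])
qed (simp add: finite_lists_length_le)

lemma route_plans_subset: "route_plans \<kappa> n \<subseteq> Pow {p. distinct p \<and> set p \<subseteq> {1..n}}"
  unfolding route_plans_def by blast

lemma finite_route_plans: "finite (route_plans \<kappa> n)"
  using finite_subset[OF route_plans_subset] finite_paths by blast

lemma finite_route_plan: "P \<in> route_plans \<kappa> n \<Longrightarrow> finite P"
  using route_plans_subset[of \<kappa> n] finite_paths[of n] finite_subset by blast

lemma route_plans_nonempty:
  assumes "\<kappa> \<ge> 1"
  shows "route_plans \<kappa> n \<noteq> {}"
proof -
  have "(\<lambda>i. [i]) ` {1..n} \<in> route_plans \<kappa> n"
    using assms unfolding route_plans_def disjoint_family_on_def by auto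
  then show ?thesis by blast
qed

text \<open>
  The last conjunct states that the demand sequence is independent of the location sequence
  (\<open>indep_var\<close> requires equal codomain types, hence \<open>indep_set\<close> on the generated sigma-algebras).
\<close>

definition demand_model ::
  "'a measure \<Rightarrow> (nat \<Rightarrow> 'a \<Rightarrow> location) \<Rightarrow> (nat \<Rightarrow> 'a \<Rightarrow> real) \<Rightarrow> real \<Rightarrow> bool" where
  "demand_model M X \<xi> \<mu> \<longleftrightarrow>
     prob_space.indep_vars M (\<lambda>_. borel) \<xi> {1..} \<and>
     (\<forall>i\<ge>1. distr M borel (\<xi> i) = distr M borel (\<xi> 1)) \<and>
     (\<forall>i\<ge>1. AE \<omega> in M. 0 \<le> \<xi> i \<omega>) \<and>
     (\<forall>i\<ge>1. integrable M (\<xi> i) \<and> (\<integral>\<omega>. \<xi> i \<omega> \<partial>M) = \<mu>) \<and>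
     prob_space.indep_set M
       {(\<lambda>\<omega>. \<lambda>i\<in>{1..}. X i \<omega>) -` A \<inter> space M |A. A \<in> sets (\<Pi>\<^sub>M i\<in>{1..}. borel)}
       {(\<lambda>\<omega>. \<lambda>i\<in>{1..}. \<xi> i \<omega>) -` A \<inter> space M |A. A \<in> sets (\<Pi>\<^sub>M i\<in>{1..}. borel)}"

end

theory Submission
  imports Defs
begin

text \<open>
  Every route among colocated customers has length \<open>2d\<close>, where \<open>d\<close> is the distance to the depot.
  In both demand models and under both policies its recourse cost is \<open>c\<close> times the number of its
  customers, with \<open>c = 0\<close> for the deterministic demands and \<open>c = 2d\<mu>/(Q + \<epsilon>)\<close> for the Bernoulli
  demands: as \<open>\<kappa>\<epsilon> \<le> Q\<close>, each positive demand \<open>Q + \<epsilon>\<close> on a route causes exactly one failure and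
  lowers the load of the vehicle by exactly \<open>\<epsilon>\<close>, which never saves or adds a trip, so that preventive
  returns do not pay. Minimising the cost thus means minimising the number of routes, which is
  \<open>n/\<kappa>\<close> up to rounding.
\<close>

subsection \<open>Route plans over colocated customers\<close>

text \<open>Makes a recourse cost proportional to route length add up to the same total for every
  plan.\<close>

lemma sum_length_route_plan:
  assumes "P \<in> route_plans \<kappa> n"
  shows "(\<Sum>p\<in>P. length p) = n"
proof -
  have "(\<Sum>p\<in>P. length p) = (\<Sum>p\<in>P. card (set p))"
    using assms by (intro sum.cong refl) (auto simp: route_plans_def distinct_card)
  also have "\<dots> = card (\<Union>p\<in>P. set p)"
    using assms finite_route_plan[OF assms]
    by (intro card_UN_disjoint[symmetric]) (auto simp: route_plans_def disjoint_family_on_def)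
  also have "\<dots> = n"
    using assms by (simp add: route_plans_def)
  finally show ?thesis .
qed

lemma card_route_plan_ge:
  assumes "P \<in> route_plans \<kappa> n"
  shows "n \<le> card P * \<kappa>"
proof -
  have "n = (\<Sum>p\<in>P. length p)"
    by (simp add: sum_length_route_plan[OF assms])
  also have "\<dots> \<le> (\<Sum>p\<in>P. \<kappa>)"
    using assms by (intro sum_mono) (auto simp: route_plans_def)
  finally show ?thesis by simp
qed

text \<open>Cutting the customers into consecutive blocks of \<open>\<kappa>\<close> wastes capacity
  only in the last block. The bound is one too large when \<open>\<kappa>\<close> divides
  \<open>n\<close>, which does not matter in the limit.\<close>

lemma small_route_plan:
  assumes "\<kappa> \<ge> 1"
  shows "\<exists>P\<in>route_plans \<kappa> n. card P \<le> n div \<kappa> + 1"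
proof -
  define r where "r b = map Suc [b * \<kappa>..<min n (b * \<kappa> + \<kappa>)]" for b
  define B where "B = {b. b * \<kappa> < n}"
  have B: "B \<subseteq> {..n div \<kappa>}"
    using assms by (auto simp: B_def less_eq_div_iff_mult_less_eq)
  \<comment> \<open>Shifting the customers by one turns block membership into integer division,
    which yields both disjointness and covering.\<close>
  have mem: "Suc i \<in> set (r b) \<longleftrightarrow> i < n \<and> i div \<kappa> = b" for i b
  proof -
    have "Suc i \<in> set (r b) \<longleftrightarrow> i < n \<and> \<kappa> * b \<le> i \<and> i < \<kappa> * Suc b"
      by (auto simp: r_def mult.commute)
    also have "\<dots> \<longleftrightarrow> i < n \<and> i div \<kappa> = b"
      using assms times_div_less_eq_dividend[of \<kappa> i] dividend_less_times_div[of \<kappa> i]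
      by (auto intro: div_nat_eqI)
    finally show ?thesis .
  qed
  have zero: "0 \<notin> set (r b)" for b
    by (auto simp: r_def)
  have disj: "set (r b) \<inter> set (r c) = {}" if "b \<noteq> c" for b c
  proof -
    have "i \<notin> set (r b) \<inter> set (r c)" for i
      using that mem zero by (cases i) auto
    then show ?thesis by blast
  qed
  have "(\<Union>p\<in>r ` B. set p) = {1..n}"
  proof (intro set_eqI)
    fix i
    show "i \<in> (\<Union>p\<in>r ` B. set p) \<longleftrightarrow> i \<in> {1..n}"
    proof (cases i)
      case 0
      then show ?thesis using zero by auto
    next
      case (Suc k)
      have "k < n \<Longrightarrow> k div \<kappa> \<in> B"
        unfolding B_def mem_Collect_eq by (rule le_less_trans[OF div_times_less_eq_dividend])
      then show ?thesis using Suc mem by auto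
    qed
  qed
  moreover have "p \<noteq> [] \<and> distinct p \<and> length p \<le> \<kappa>" if "p \<in> r ` B" for p
    using that assms by (auto simp: r_def B_def distinct_map)
  moreover have "disjoint_family_on set (r ` B)"
    unfolding disjoint_family_on_def
  proof (intro ballI impI)
    fix p q assume "p \<in> r ` B" "q \<in> r ` B" "p \<noteq> q"
    then obtain b c where "p = r b" "q = r c" "b \<noteq> c" by blast
    then show "set p \<inter> set q = {}" by (simp add: disj)
  qed
  ultimately have "r ` B \<in> route_plans \<kappa> n"
    by (simp add: route_plans_def)
  moreover have "card (r ` B) \<le> n div \<kappa> + 1"
    using card_image_le[of B r] card_mono[OF _ B] finite_subset[OF B] by simp
  ultimately show ?thesis by blast
qed

lemma route_length_colocated:
  assumes "x 0 = 0" and "\<And>i. i \<ge> 1 \<Longrightarrow> x i = xs" and "p \<noteq> []" and "0 \<notin> set p"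
  shows "route_length x p = 2 * norm xs"
proof -
  define r where "r = 0 # p @ [0]"
  have pos: "x (p ! k) = xs" if "k < length p" for k
    using assms(2,4) nth_mem[OF that] by (metis less_one not_le)
  have node: "x (r ! j) = (if j = 0 \<or> j = Suc (length p) then 0 else xs)" if "j \<le> Suc (length p)" for j
    using that pos assms(1) by (cases j) (auto simp: r_def nth_append)
  have "route_length x p = (\<Sum>j\<le>length p. norm (x (r ! j) - x (r ! Suc j)))"
    by (simp add: route_length_def r_def)
  \<comment> \<open>Only the legs leaving and entering the depot can be nonzero; these are two
    different legs since \<open>p\<close> is nonempty.\<close>
  also have "\<dots> = (\<Sum>j\<le>length p. if j = 0 \<or> j = length p then norm xs else 0)"
    using \<open>p \<noteq> []\<close> by (intro sum.cong) (auto simp: node)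
  also have "\<dots> = (\<Sum>j\<in>{0, length p}. norm xs)"
    by (intro sum.mono_neutral_cong_right) auto
  also have "\<dots> = 2 * norm xs"
    using \<open>p \<noteq> []\<close> by simp
  finally show ?thesis .
qed

text \<open>With recourse proportional to length, the cost of a plan depends only on its number of
  routes. The optimum lies between the costs of \<open>n / \<kappa>\<close> and
  \<open>n / \<kappa> + 1\<close> routes, and the gap vanishes after division by
  \<open>n\<close>.\<close>

lemma opt_value_limit:
  assumes x: "x 0 = 0" "\<And>i. i \<ge> 1 \<Longrightarrow> x i = xs"
    and \<kappa>: "\<kappa> \<ge> 1"
    and rec: "\<And>p. 0 \<notin> set p \<Longrightarrow> length p \<le> \<kappa> \<Longrightarrow> recourse \<pi> M \<xi> Q x p = c * real (length p)"
  shows "(\<lambda>n. opt_value \<pi> M \<xi> Q \<kappa> x n / real n) \<longlonglongrightarrow> 2 * norm xs / real \<kappa> + c"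
proof -
  let ?cost = "\<lambda>P. \<Sum>p\<in>P. route_length x p + recourse \<pi> M \<xi> Q x p"
  have cost: "?cost P = 2 * norm xs * real (card P) + c * real n"
    if P: "P \<in> route_plans \<kappa> n" for P n
  proof -
    have "?cost P = (\<Sum>p\<in>P. 2 * norm xs + c * real (length p))"
    proof (intro sum.cong refl)
      fix p assume p: "p \<in> P"
      then have "set p \<subseteq> {1..n}" "p \<noteq> []" "length p \<le> \<kappa>"
        using P by (auto simp: route_plans_def)
      moreover from this have "0 \<notin> set p" by auto
      ultimately show "route_length x p + recourse \<pi> M \<xi> Q x p = 2 * norm xs + c * real (length p)"
        using route_length_colocated[of x xs p] x rec[of p] by simp
    qed
    also have "\<dots> = 2 * norm xs * real (card P) + c * real (\<Sum>p\<in>P. length p)"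
      by (simp add: sum.distrib sum_distrib_left)
    finally show ?thesis by (simp add: sum_length_route_plan[OF P])
  qed
  have lower: "2 * norm xs * (real n / real \<kappa>) + c * real n \<le> opt_value \<pi> M \<xi> Q \<kappa> x n" for n
  proof -
    have "2 * norm xs * (real n / real \<kappa>) + c * real n \<le> ?cost P" if P: "P \<in> route_plans \<kappa> n" for P
    proof -
      have "real n \<le> real (card P) * real \<kappa>"
        using card_route_plan_ge[OF P] by (metis of_nat_le_iff of_nat_mult)
      then have "real n / real \<kappa> \<le> real (card P)"
        using \<kappa> by (simp add: divide_le_eq)
      then show ?thesis
        unfolding cost[OF P] by (intro add_mono mult_left_mono order_refl) auto
    qed
    then show ?thesis
      unfolding opt_value_def using route_plans_nonempty[OF \<kappa>] finite_route_plans
      by (intro Min.boundedI) auto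
  qed
  have upper: "opt_value \<pi> M \<xi> Q \<kappa> x n \<le> 2 * norm xs * (real n / real \<kappa> + 1) + c * real n" for n
  proof -
    obtain P where P: "P \<in> route_plans \<kappa> n" "card P \<le> n div \<kappa> + 1"
      using small_route_plan[OF \<kappa>] by blast
    have "real (card P) \<le> real (n div \<kappa>) + 1"
      using P(2) by linarith
    also have "\<dots> \<le> real n / real \<kappa> + 1"
      using of_nat_div_le_of_nat by simp
    finally have "?cost P \<le> 2 * norm xs * (real n / real \<kappa> + 1) + c * real n"
      unfolding cost[OF P(1)] by (intro add_mono mult_left_mono order_refl) auto
    moreover have "opt_value \<pi> M \<xi> Q \<kappa> x n \<le> ?cost P"
      unfolding opt_value_def using P(1) finite_route_plans by (intro Min_le) auto
    ultimately show ?thesis by linarith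
  qed
  show ?thesis
  proof (rule tendsto_sandwich)
    show "\<forall>\<^sub>F n in sequentially. 2 * norm xs / real \<kappa> + c \<le> opt_value \<pi> M \<xi> Q \<kappa> x n / real n"
      using eventually_gt_at_top[of 0]
    proof eventually_elim
      case (elim n)
      then show ?case using lower[of n] by (simp add: le_divide_eq algebra_simps)
    qed
    \<comment> \<open>The last term of the bound is the length of one surplus route, spread over
      \<open>n\<close> customers.\<close>
    show "\<forall>\<^sub>F n in sequentially. opt_value \<pi> M \<xi> Q \<kappa> x n / real n
        \<le> 2 * norm xs / real \<kappa> + c + 2 * norm xs * inverse (real n)"
      using eventually_gt_at_top[of 0]
    proof eventually_elim
      case (elim n)
      then have "(2 * norm xs / real \<kappa> + c + 2 * norm xs * inverse (real n)) * real n
          = 2 * norm xs * (real n / real \<kappa> + 1) + c * real n"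
        by (simp add: field_simps)
      then show ?case using elim upper[of n] by (simp add: divide_le_eq)
    qed
    have "(\<lambda>n. 2 * norm xs / real \<kappa> + c + 2 * norm xs * inverse (real n))
        \<longlonglongrightarrow> 2 * norm xs / real \<kappa> + c + 2 * norm xs * 0"
      by (intro tendsto_intros lim_inverse_n)
    then show "(\<lambda>n. 2 * norm xs / real \<kappa> + c + 2 * norm xs * inverse (real n))
        \<longlonglongrightarrow> 2 * norm xs / real \<kappa> + c" by simp
  qed simp
qed

text \<open>Reversal keeps the customers and the length of a path, so both directions satisfy the
  hypotheses and the minimum is over two equal values.\<close>

lemma recourse_eq:
  assumes "\<And>p. 0 \<notin> set p \<Longrightarrow> length p \<le> \<kappa> \<Longrightarrow> dtd_recourse M \<xi> Q x p = c * real (length p)"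
    and "\<And>p. 0 \<notin> set p \<Longrightarrow> length p \<le> \<kappa> \<Longrightarrow> or_recourse M \<xi> Q x p = c * real (length p)"
    and "0 \<notin> set p" "length p \<le> \<kappa>"
  shows "recourse \<pi> M \<xi> Q x p = c * real (length p)"
  using assms by (cases \<pi>) (simp_all add: recourse_def)

subsection \<open>Recourse cost\<close>

lemma refills_measurable [measurable]:
  assumes [measurable]: "f \<in> borel_measurable N" "g \<in> borel_measurable N"
  shows "(\<lambda>z. refills Q (f z) (g z)) \<in> borel_measurable N"
  unfolding refills_def of_int_max by measurable

lemma refills_zero:
  assumes "Q > 0" "s \<le> q"
  shows "refills Q s q = 0"
proof -
  have "(s - q) / Q \<le> 0"
    using assms by (simp add: divide_le_0_iff)
  then have "\<lceil>(s - q) / Q\<rceil> \<le> 0" by (simp add: ceiling_le_iff)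
  then show ?thesis by (simp add: refills_def)
qed

lemma refills_one:
  assumes "Q > 0" "q < s" "s \<le> q + Q"
  shows "refills Q s q = 1"
proof -
  have "0 < (s - q) / Q" "(s - q) / Q \<le> 1"
    using assms by (simp_all add: divide_le_eq)
  then have "\<lceil>(s - q) / Q\<rceil> = 1" by (intro ceiling_unique) auto
  then show ?thesis by (simp add: refills_def)
qed

lemma return_cost_nonneg: "return_cost x i j \<ge> 0"
  unfolding return_cost_def using norm_triangle_ineq4[of "x i" "x j"] by simp

text \<open>
  If \<open>m\<close> of the earlier demands are positive, the only refill level between \<open>m(Q + \<epsilon>)\<close> and
  \<open>(m + 1)(Q + \<epsilon>)\<close> is \<open>(m + 1)Q\<close>. Hence a failure at position \<open>j\<close> is the event that the demand
  at \<open>j\<close> is positive, split according to the total of the earlier demands.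
\<close>

lemma failure_level_iff:
  fixes \<epsilon> Q :: real
  assumes "\<epsilon> > 0" "real (Suc m) * \<epsilon> \<le> Q"
  shows "real m * (Q + \<epsilon>) \<le> real (Suc l) * Q \<and> real (Suc l) * Q < real (Suc m) * (Q + \<epsilon>) \<longleftrightarrow> l = m"
proof
  have m: "0 \<le> real m * \<epsilon>" using assms(1) by simp
  have Suc: "real (Suc m) * \<epsilon> = real m * \<epsilon> + \<epsilon>" by (simp add: algebra_simps)
  then have Q: "Q > 0" using assms m by linarith
  show "l = m" if *: "real m * (Q + \<epsilon>) \<le> real (Suc l) * Q \<and> real (Suc l) * Q < real (Suc m) * (Q + \<epsilon>)"
  proof (rule ccontr)
    assume "l \<noteq> m"
    then consider "Suc l \<le> m" | "Suc (Suc m) \<le> Suc l" by linarith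
    \<comment> \<open>Lower levels are already exceeded before position \<open>j\<close>, since
      \<open>(l + 1) Q \<le> m Q < m (Q + \<epsilon>)\<close>; higher ones are out of reach, since
      \<open>(l + 1) Q \<ge> (m + 2) Q \<ge> (m + 1) (Q + \<epsilon>)\<close>.\<close>
    then show False
    proof cases
      case 1
      then have "real (Suc l) * Q \<le> real m * Q"
        using Q by (intro mult_right_mono) auto
      moreover have "0 < real m * \<epsilon>" using 1 assms(1) by simp
      ultimately show False using * by (simp add: algebra_simps)
    next
      case 2
      then have "real (Suc (Suc m)) * Q \<le> real (Suc l) * Q"
        using Q by (intro mult_right_mono) auto
      then show False using * assms(2) by (simp add: algebra_simps)
    qed
  qed
  show "real m * (Q + \<epsilon>) \<le> real (Suc l) * Q \<and> real (Suc l) * Q < real (Suc m) * (Q + \<epsilon>)" if "l = m"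
    using assms m Suc unfolding that distrib_left[of _ Q] of_nat_Suc distrib_right[of _ _ Q] by linarith
qed

context prob_space
begin

section \<open>Measurability and shape of the restocking costs\<close>

lemma serve_cost_measurable [measurable]:
  assumes [measurable]: "\<xi> i \<in> borel_measurable M" "G \<in> borel_measurable borel"
  shows "serve_cost M \<xi> Q x i G \<in> borel_measurable borel"
proof -
  have "(\<lambda>q. \<integral>\<omega>. failure_cost x i * refills Q (\<xi> i \<omega>) q
      + G (refills Q (\<xi> i \<omega>) q * Q + q - \<xi> i \<omega>) \<partial>M) \<in> borel_measurable borel"
    by measurable
  then show ?thesis unfolding serve_cost_def[abs_def] .
qed

text \<open>Each cost-to-go enters the preceding serving cost under an integral, so measurability
  has to be carried along the path.\<close>

lemma restock_cost_measurable:
  assumes "\<And>j. j \<in> set p \<Longrightarrow> \<xi> j \<in> borel_measurable M"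
  shows "restock_cost M \<xi> Q x i p \<in> borel_measurable borel"
  using assms
proof (induction p arbitrary: i)
  case (Cons j p)
  have [measurable]: "restock_cost M \<xi> Q x j p \<in> borel_measurable borel" "\<xi> j \<in> borel_measurable M"
    using Cons by auto
  show ?case by (simp add: Let_def)
qed simp

text \<open>Here the load is fixed and the demand varies: the form needed to pass from
  \<open>M\<close> to the law of the demand.\<close>

lemma serve_cost_integral_measurable:
  assumes [measurable]: "G \<in> borel_measurable borel"
  shows "(\<lambda>s. failure_cost x i * refills Q s q + G (refills Q s q * Q + q - s)) \<in> borel_measurable borel"
  by measurable

text \<open>
  The loads \<open>Q - m\<delta>\<close> are those reached without preventive return if every positive demand lowers
  the load by \<open>\<delta>\<close>; along them the cost-to-go depends only on the number of remaining customers.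
\<close>

lemma restock_cost_linear:
  fixes \<delta> c :: real
  assumes serve: "\<And>i G m b. i \<ge> 1 \<Longrightarrow> m < \<kappa> \<Longrightarrow> G \<in> borel_measurable borel \<Longrightarrow>
        G (Q - real m * \<delta>) = b \<Longrightarrow> G (Q - real (Suc m) * \<delta>) = b \<Longrightarrow>
        serve_cost M \<xi> Q x i G (Q - real m * \<delta>) = b + c"
    and meas: "\<And>i. i \<ge> 1 \<Longrightarrow> \<xi> i \<in> borel_measurable M"
    and "0 \<notin> set p" "m + length p \<le> \<kappa>"
  shows "restock_cost M \<xi> Q x i p (Q - real m * \<delta>) = c * real (length p)"
  using assms(3,4)
proof (induction p arbitrary: i m)
  case (Cons j p)
  let ?G = "restock_cost M \<xi> Q x j p"
  have G: "?G \<in> borel_measurable borel"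
    using Cons.prems by (intro restock_cost_measurable meas) (auto simp: Suc_le_eq intro: gr0I)
  have j: "j \<ge> 1" using Cons.prems by (cases j) auto
  \<comment> \<open>Both loads compared by the minimum are covered: \<open>k = m\<close> is direct
    service, \<open>k = 0\<close> follows a preventive return. The values agree, so a nonnegative
    return cost never pays.\<close>
  have "serve_cost M \<xi> Q x j ?G (Q - real k * \<delta>) = c * real (length p) + c" if "k \<le> m" for k
  proof (intro serve[OF j _ G])
    show "?G (Q - real k * \<delta>) = c * real (length p)" "?G (Q - real (Suc k) * \<delta>) = c * real (length p)"
      using Cons.prems that Cons.IH[of k j] Cons.IH[of "Suc k" j] by (simp_all del: of_nat_Suc)
  qed (use Cons.prems that in auto)
  from this[of m] this[of 0] show ?case
    using return_cost_nonneg[of x i j] by (simp add: Let_def algebra_simps)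
qed simp

section \<open>Deterministic demands\<close>

lemma serve_cost_deterministic:
  fixes \<mu> :: real
  assumes "\<mu> > 0" "real \<kappa> * \<mu> \<le> Q" "m < \<kappa>"
    and meas [measurable]: "\<xi> i \<in> borel_measurable M" "G \<in> borel_measurable borel"
    and const: "AE \<omega> in M. \<xi> i \<omega> = \<mu>"
    and G: "G (Q - real (Suc m) * \<mu>) = b"
  shows "serve_cost M \<xi> Q x i G (Q - real m * \<mu>) = b"
proof -
  let ?q = "Q - real m * \<mu>"
  have "real (Suc m) * \<mu> \<le> real \<kappa> * \<mu>"
    using assms by (intro mult_right_mono) auto
  \<comment> \<open>Even the last customer of a full route finds a load of at least
    \<open>\<mu>\<close>, so no refill occurs.\<close>
  then have le: "real m * \<mu> + \<mu> \<le> Q"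
    using assms by (simp add: algebra_simps)
  have "Q > 0"
    using le assms(1) by (smt (verit) mult_nonneg_nonneg of_nat_0_le_iff)
  then have "refills Q \<mu> ?q = 0"
    using le by (intro refills_zero) auto
  then have "AE \<omega> in M. failure_cost x i * refills Q (\<xi> i \<omega>) ?q + G (refills Q (\<xi> i \<omega>) ?q * Q + ?q - \<xi> i \<omega>) = b"
    using const G by (auto simp: algebra_simps)
  then have "serve_cost M \<xi> Q x i G ?q = (\<integral>\<omega>. b \<partial>M)"
    unfolding serve_cost_def by (intro integral_cong_AE) auto
  then show ?thesis by (simp add: prob_space)
qed

text \<open>Almost surely the cumulative demand on a route stays at most
  \<open>real \<kappa> * \<mu> \<le> Q\<close>, so even the lowest level is never exceeded.\<close>

lemma dtd_recourse_deterministic: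
  fixes \<mu> :: real
  assumes "\<mu> > 0" "real \<kappa> * \<mu> \<le> Q"
    and meas: "\<And>i. i \<ge> 1 \<Longrightarrow> \<xi> i \<in> borel_measurable M"
    and const: "\<And>i. i \<ge> 1 \<Longrightarrow> AE \<omega> in M. \<xi> i \<omega> = \<mu>"
    and p: "0 \<notin> set p" "length p \<le> \<kappa>"
  shows "dtd_recourse M \<xi> Q x p = 0"
proof -
  have ge: "p ! k \<ge> 1" if "k < length p" for k
    using p(1) nth_mem[OF that] by (metis less_one not_le)
  have "prob {\<omega> \<in> space M. (\<Sum>k<j. \<xi> (p ! k) \<omega>) \<le> real (Suc l) * Q \<and>
      real (Suc l) * Q < (\<Sum>k\<le>j. \<xi> (p ! k) \<omega>)} = 0" (is "prob ?E = 0") if j: "j < length p" for j l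
  proof -
    have "AE \<omega> in M. \<forall>k\<in>{..j}. \<xi> (p ! k) \<omega> = \<mu>"
      using j by (intro AE_finite_allI const ge) auto
    then have "AE \<omega> in M. \<omega> \<notin> ?E"
    proof eventually_elim
      case (elim \<omega>)
      have "(\<Sum>k\<le>j. \<xi> (p ! k) \<omega>) = real (Suc j) * \<mu>"
        using elim by simp
      also have "\<dots> \<le> real \<kappa> * \<mu>"
        using assms j by (intro mult_right_mono) auto
      also have "\<dots> \<le> Q" by fact
      also have "Q \<le> real (Suc l) * Q"
      proof -
        have "0 \<le> Q"
          using assms by (smt (verit) mult_nonneg_nonneg of_nat_0_le_iff)
        then show ?thesis by (simp add: algebra_simps)
      qed
      finally show ?case by auto
    qed
    \<comment> \<open>Outside the sigma-algebra the measure is 0 by convention, so both cases give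
      0.\<close>
    then show ?thesis
      by (cases "?E \<in> sets M") (simp_all add: prob_eq_0 measure_notin_sets)
  qed
  then show ?thesis
    by (simp add: dtd_recourse_def)
qed

section \<open>Bernoulli demands\<close>

lemma bernoulli_demand_integral:
  fixes B p :: real
  assumes "0 \<le> p" "p \<le> 1" and [measurable]: "Y \<in> borel_measurable M" "f \<in> borel_measurable borel"
    and distr: "distr M borel Y = distr (measure_pmf (bernoulli_pmf p)) borel (\<lambda>b. B * of_bool b)"
  shows "(\<integral>\<omega>. f (Y \<omega>) \<partial>M) = p * f B + (1 - p) * (f 0 :: real)"
proof -
  have "(\<integral>\<omega>. f (Y \<omega>) \<partial>M) = (\<integral>s. f s \<partial>distr M borel Y)"
    by (simp add: integral_distr)
  also have "\<dots> = (\<integral>b. f (B * of_bool b) \<partial>measure_pmf (bernoulli_pmf p))"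
    unfolding distr by (intro integral_distr) auto
  also have "\<dots> = p * f B + (1 - p) * f 0"
    using assms(1,2) by simp
  finally show ?thesis .
qed

lemma bernoulli_demand_AE:
  fixes B p :: real
  assumes [measurable]: "Y \<in> borel_measurable M"
    and distr: "distr M borel Y = distr (measure_pmf (bernoulli_pmf p)) borel (\<lambda>b. B * of_bool b)"
  shows "AE \<omega> in M. Y \<omega> = 0 \<or> Y \<omega> = B"
proof -
  have "AE s in distr (measure_pmf (bernoulli_pmf p)) borel (\<lambda>b. B * of_bool b). s = 0 \<or> s = B"
    by (subst AE_distr_iff) auto
  then show ?thesis
    unfolding distr[symmetric] by (subst (asm) AE_distr_iff) auto
qed

lemma bernoulli_demand_prob:
  fixes B p :: real
  assumes "0 \<le> p" "p \<le> 1" "B \<noteq> 0" and [measurable]: "Y \<in> borel_measurable M"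
    and distr: "distr M borel Y = distr (measure_pmf (bernoulli_pmf p)) borel (\<lambda>b. B * of_bool b)"
  shows "prob {\<omega> \<in> space M. Y \<omega> = B} = p"
proof -
  have "prob {\<omega> \<in> space M. Y \<omega> = B} = (\<integral>\<omega>. indicator {\<omega> \<in> space M. Y \<omega> = B} \<omega> \<partial>M)"
    by simp
  also have "\<dots> = (\<integral>\<omega>. indicator {B} (Y \<omega>) \<partial>M)"
    by (intro Bochner_Integration.integral_cong) (auto simp: indicator_def)
  \<comment> \<open>Since \<open>B \<noteq> 0\<close>, the atom at 0 does not contribute to the
    indicator of \<open>{B}\<close>.\<close>
  also have "\<dots> = p"
    using assms(3) by (subst bernoulli_demand_integral[OF assms(1,2) _ _ distr]) auto
  finally show ?thesis .
qed

text \<open>A zero demand leaves the load alone. A demand of \<open>Q + \<epsilon>\<close> exceeds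
  the load but needs only one refill, after which the load has dropped by \<open>\<epsilon>\<close>.
  As \<open>G\<close> takes the value \<open>b\<close> at both resulting loads, only the expected
  failure cost is added.\<close>

lemma serve_cost_bernoulli:
  fixes \<epsilon> p :: real
  assumes p: "0 \<le> p" "p \<le> 1" and "Q > 0" "\<epsilon> > 0" "real \<kappa> * \<epsilon> \<le> Q" "m < \<kappa>"
    and meas [measurable]: "\<xi> i \<in> borel_measurable M" "G \<in> borel_measurable borel"
    and distr: "distr M borel (\<xi> i) = distr (measure_pmf (bernoulli_pmf p)) borel (\<lambda>b. (Q + \<epsilon>) * of_bool b)"
    and G: "G (Q - real m * \<epsilon>) = b" "G (Q - real (Suc m) * \<epsilon>) = b"
  shows "serve_cost M \<xi> Q x i G (Q - real m * \<epsilon>) = b + failure_cost x i * p"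
proof -
  let ?q = "Q - real m * \<epsilon>"
  have "real (Suc m) * \<epsilon> \<le> real \<kappa> * \<epsilon>"
    using assms by (intro mult_right_mono) auto
  then have le: "real m * \<epsilon> + \<epsilon> \<le> Q"
    using assms by (simp add: algebra_simps)
  have "0 \<le> real m * \<epsilon>" using assms by simp
  \<comment> \<open>The second bound amounts to \<open>?q \<ge> \<epsilon>\<close>, which
    \<open>real \<kappa> * \<epsilon> \<le> Q\<close> guarantees for \<open>m < \<kappa>\<close>: a
    single refill suffices.\<close>
  then have "?q < Q + \<epsilon>" "Q + \<epsilon> \<le> ?q + Q" "0 \<le> ?q"
    using le assms(4) by linarith+
  then have r: "refills Q (Q + \<epsilon>) ?q = 1" "refills Q 0 ?q = 0"
    using assms(3) by (auto intro: refills_one refills_zero)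
  have "serve_cost M \<xi> Q x i G ?q
      = p * (failure_cost x i * refills Q (Q + \<epsilon>) ?q + G (refills Q (Q + \<epsilon>) ?q * Q + ?q - (Q + \<epsilon>)))
      + (1 - p) * (failure_cost x i * refills Q 0 ?q + G (refills Q 0 ?q * Q + ?q - 0))"
    unfolding serve_cost_def
    by (rule bernoulli_demand_integral[OF p meas(1) serve_cost_integral_measurable[OF meas(2)] distr])
  also have "\<dots> = p * (failure_cost x i + b) + (1 - p) * b"
  proof -
    have "1 * Q + ?q - (Q + \<epsilon>) = Q - real (Suc m) * \<epsilon>" by (simp add: algebra_simps)
    then show ?thesis using G unfolding r by simp
  qed
  also have "\<dots> = b + failure_cost x i * p"
    by (simp add: algebra_simps)
  finally show ?thesis .
qed

text \<open>Each position contributes \<open>f * \<rho>\<close>: up to null sets the level events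
  are the disjoint events \<open>D l\<close>, whose union is a positive demand at \<open>j\<close>,
  so countable additivity sums the series.\<close>

lemma dtd_recourse_bernoulli:
  fixes \<epsilon> \<rho> :: real
  assumes \<rho>: "0 \<le> \<rho>" "\<rho> \<le> 1" and "Q > 0" "\<epsilon> > 0" "real \<kappa> * \<epsilon> \<le> Q"
    and meas: "\<And>i. i \<ge> 1 \<Longrightarrow> \<xi> i \<in> borel_measurable M"
    and distr: "\<And>i. i \<ge> 1 \<Longrightarrow> distr M borel (\<xi> i)
        = distr (measure_pmf (bernoulli_pmf \<rho>)) borel (\<lambda>b. (Q + \<epsilon>) * of_bool b)"
    and p: "0 \<notin> set p" "length p \<le> \<kappa>"
    and x: "\<And>i. i \<ge> 1 \<Longrightarrow> failure_cost x i = f"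
  shows "dtd_recourse M \<xi> Q x p = f * \<rho> * real (length p)"
proof -
  define B where "B = Q + \<epsilon>"
  have B: "B > 0" using assms by (simp add: B_def)
  have ge: "p ! k \<ge> 1" if "k < length p" for k
    using p(1) nth_mem[OF that] by (metis less_one not_le)
  have "(\<Sum>l. prob {\<omega> \<in> space M. (\<Sum>k<j. \<xi> (p ! k) \<omega>) \<le> real (Suc l) * Q \<and>
      real (Suc l) * Q < (\<Sum>k\<le>j. \<xi> (p ! k) \<omega>)} * failure_cost x (p ! j)) = f * \<rho>"
    (is "(\<Sum>l. prob (?E l) * _) = _") if j: "j < length p" for j
  proof -
    \<comment> \<open>Up to a null set, \<open>D l\<close> says that the demand at \<open>j\<close>
      and exactly \<open>l\<close> earlier ones are positive, which is when level
      \<open>Suc l\<close> is crossed.\<close>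
    define D where "D l = {\<omega> \<in> space M. (\<Sum>k<j. \<xi> (p ! k) \<omega>) = real l * B \<and> \<xi> (p ! j) \<omega> = B}" for l
    have \<xi> [measurable]: "\<xi> (p ! k) \<in> borel_measurable M" if "k \<le> j" for k
      using that j by (intro meas ge) auto
    have sums_measurable [measurable]: "(\<lambda>\<omega>. \<Sum>k<j. \<xi> (p ! k) \<omega>) \<in> borel_measurable M"
      "(\<lambda>\<omega>. \<Sum>k\<le>j. \<xi> (p ! k) \<omega>) \<in> borel_measurable M"
      by (intro borel_measurable_sum \<xi>; simp)+
    have [measurable]: "\<xi> (p ! j) \<in> borel_measurable M" by (rule \<xi>) simp
    have D_sets [measurable]: "D l \<in> sets M" for l
      unfolding D_def by measurable
    have AE: "AE \<omega> in M. \<forall>k\<in>{..j}. \<xi> (p ! k) \<omega> = 0 \<or> \<xi> (p ! k) \<omega> = B"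
      using j by (intro AE_finite_allI bernoulli_demand_AE[OF _ distr[folded B_def]] \<xi> ge) auto
    have count: "\<exists>m\<le>j. (\<Sum>k<j. \<xi> (p ! k) \<omega>) = real m * B"
      if "\<forall>k\<in>{..j}. \<xi> (p ! k) \<omega> = 0 \<or> \<xi> (p ! k) \<omega> = B" for \<omega>
    proof (intro exI conjI)
      let ?K = "{k\<in>{..<j}. \<xi> (p ! k) \<omega> = B}"
      show "card ?K \<le> j" using card_mono[of "{..<j}" ?K] by auto
      have "(\<Sum>k<j. \<xi> (p ! k) \<omega>) = (\<Sum>k\<in>?K. B)"
        using that by (intro sum.mono_neutral_cong_right) auto
      then show "(\<Sum>k<j. \<xi> (p ! k) \<omega>) = real (card ?K) * B" by simp
    qed
    have ED: "prob (?E l) = prob (D l)" for l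
    proof (rule finite_measure_eq_AE)
      show "AE \<omega> in M. \<omega> \<in> ?E l \<longleftrightarrow> \<omega> \<in> D l"
        using AE AE_space
      proof eventually_elim
        case (elim \<omega>)
        obtain m where m: "m \<le> j" "(\<Sum>k<j. \<xi> (p ! k) \<omega>) = real m * B"
          using count elim(1) by blast
        have last: "(\<Sum>k\<le>j. \<xi> (p ! k) \<omega>) = real m * B + \<xi> (p ! j) \<omega>"
          using m(2) by (simp add: lessThan_Suc_atMost[symmetric])
        have "real (Suc m) * \<epsilon> \<le> real \<kappa> * \<epsilon>"
          using m(1) j p(2) assms(4) by (intro mult_right_mono) auto
        then have "real (Suc m) * \<epsilon> \<le> Q" using assms(5) by linarith
        note level = failure_level_iff[OF assms(4) this, folded B_def]
        show ?case
        proof (cases "\<xi> (p ! j) \<omega> = B")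
          case True
          then have "real m * B + \<xi> (p ! j) \<omega> = real (Suc m) * B" by (simp add: algebra_simps)
          then show ?thesis
            using level[of l] B elim(2) True unfolding D_def mem_Collect_eq last m(2) by auto
        next
          \<comment> \<open>With zero demand at \<open>j\<close> the two partial sums coincide, so
            no level is crossed.\<close>
          case False
          then have "\<xi> (p ! j) \<omega> = 0" using elim(1) by blast
          then show ?thesis using B unfolding D_def mem_Collect_eq last m(2) by auto
        qed
      qed
    qed measurable
    have "(\<lambda>l. prob (D l)) sums prob (\<Union>l. D l)"
      using B by (intro finite_measure_UNION) (auto simp: disjoint_family_on_def D_def)
    \<comment> \<open>Almost surely the earlier total is some multiple of \<open>B\<close>, so the
      union imposes no condition on it.\<close>
    also have "prob (\<Union>l. D l) = prob {\<omega> \<in> space M. \<xi> (p ! j) \<omega> = B}"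
    proof (rule finite_measure_eq_AE)
      show "AE \<omega> in M. \<omega> \<in> (\<Union>l. D l) \<longleftrightarrow> \<omega> \<in> {\<omega> \<in> space M. \<xi> (p ! j) \<omega> = B}"
        using AE
      proof eventually_elim
        case (elim \<omega>)
        then show ?case using count[of \<omega>] by (auto simp: D_def)
      qed
    qed measurable
    also have "\<dots> = \<rho>"
      using B by (intro bernoulli_demand_prob[OF \<rho> _ _ distr[folded B_def]] \<xi> ge j) auto
    finally have "(\<lambda>l. prob (D l) * f) sums (\<rho> * f)"
      by (rule sums_mult2)
    then show ?thesis
      unfolding ED x[OF ge[OF j]] by (simp add: sums_iff mult.commute)
  qed
  then show ?thesis
    by (simp add: dtd_recourse_def mult.commute)
qed

end

section \<open>Limits of the optimal value\<close>

theorem proposition7: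
  fixes M :: "'a measure"
    and X :: "nat \<Rightarrow> 'a \<Rightarrow> real^2"
    and xstar :: "real^2"
    and \<mu> Q \<alpha> dbar :: real
    and \<kappa> :: nat
    and \<pi> :: policy
  assumes "prob_space M"
    and "0 < \<mu>" and "\<mu> \<le> Q"
    and "\<kappa> = nat \<lfloor>Q / \<mu>\<rfloor>"
    and "\<alpha> = Q / (\<mu> * real \<kappa>)"
    and "\<And>\<omega>. \<omega> \<in> space M \<Longrightarrow> X 0 \<omega> = 0"
    and "\<And>i. i \<ge> 1 \<Longrightarrow> X i \<in> borel_measurable M"
    and "norm xstar > 0"
    and "\<And>i. i \<ge> 1 \<Longrightarrow> AE \<omega> in M. X i \<omega> = xstar"
    and "\<And>i. i \<ge> 1 \<Longrightarrow> dbar = (\<integral>\<omega>. norm (X i \<omega>) \<partial>M)"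
  shows "dbar = norm xstar \<and>
    (\<forall>\<xi>. demand_model M X \<xi> \<mu> \<and> (\<forall>i\<ge>1. AE \<omega> in M. \<xi> i \<omega> = \<mu>) \<longrightarrow>
      (AE \<omega> in M. (\<lambda>n. opt_value \<pi> M \<xi> Q \<kappa> (\<lambda>i. X i \<omega>) n / real n)
         \<longlonglongrightarrow> \<alpha> * (2 * \<mu> * dbar / Q))) \<and>
    (\<forall>\<epsilon>\<in>{0<..Q / real \<kappa>}. \<forall>\<xi>. demand_model M X \<xi> \<mu> \<and>
      (\<forall>i\<ge>1. distr M borel (\<xi> i) =
         distr (measure_pmf (bernoulli_pmf (\<mu> / (Q + \<epsilon>)))) borel (\<lambda>b. (Q + \<epsilon>) * of_bool b)) \<longrightarrow>
      (AE \<omega> in M. (\<lambda>n. opt_value \<pi> M \<xi> Q \<kappa> (\<lambda>i. X i \<omega>) n / real n)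
         \<longlonglongrightarrow> \<alpha> * (2 * \<mu> * dbar / Q) + 2 * \<mu> * dbar / (Q + \<epsilon>))) \<and>
    ((\<lambda>\<epsilon>. \<alpha> * (2 * \<mu> * dbar / Q) + 2 * \<mu> * dbar / (Q + \<epsilon>))
       \<longlongrightarrow> (\<alpha> + 1) * (2 * \<mu> * dbar / Q)) (at_right 0)"
proof -
  interpret prob_space M by fact
  have \<kappa>_real: "real \<kappa> = of_int \<lfloor>Q / \<mu>\<rfloor>"
    using assms(2-4) by simp
  have "1 \<le> Q / \<mu>"
    using assms(2,3) by simp
  then have "1 \<le> \<lfloor>Q / \<mu>\<rfloor>" by (simp add: le_floor_iff)
  then have \<kappa>: "\<kappa> \<ge> 1"
    using assms(4) by linarith
  have "real \<kappa> \<le> Q / \<mu>"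
    unfolding \<kappa>_real by simp
  then have \<kappa>\<mu>: "real \<kappa> * \<mu> \<le> Q"
    using assms(2) by (simp add: le_divide_eq)
  have Q: "Q > 0" using assms(2,3) by linarith
  have "(\<integral>\<omega>. norm (X 1 \<omega>) \<partial>M) = (\<integral>\<omega>. norm xstar \<partial>M)"
    using assms(7)[of 1] assms(9)[of 1] by (intro integral_cong_AE) auto
  then have dbar: "dbar = norm xstar"
    using assms(10)[of 1] by (simp add: prob_space)
  \<comment> \<open>\<open>\<alpha>\<close> undoes the rounding in \<open>\<kappa>\<close>: the rate
    is one round trip per \<open>\<kappa>\<close> customers.\<close>
  have rate: "\<alpha> * (2 * \<mu> * dbar / Q) = 2 * norm xstar / real \<kappa>"
    using \<kappa> Q assms(2) by (simp add: assms(5) dbar)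
  \<comment> \<open>Countably many customers allow a single exceptional null set.\<close>
  have "AE \<omega> in M. \<forall>i\<in>{1..}. X i \<omega> = xstar"
    by (intro AE_ball_countable') (auto intro: assms(9))
  then have loc: "AE \<omega> in M. X 0 \<omega> = 0 \<and> (\<forall>i\<ge>1. X i \<omega> = xstar)"
    using AE_space by eventually_elim (auto simp: assms(6))
  have meas: "\<xi> i \<in> borel_measurable M" if "demand_model M X \<xi> \<mu>" "i \<ge> 1" for \<xi> i
    using that by (auto simp: demand_model_def indep_vars_def)
  \<comment> \<open>The recourse costs are evaluated for every fixed realization with all customers
    at \<open>xstar\<close>, so the deterministic limit applies to almost every
    \<open>\<omega>\<close>.\<close>
  have limit: "AE \<omega> in M. (\<lambda>n. opt_value \<pi> M \<xi> Q \<kappa> (\<lambda>i. X i \<omega>) n / real n)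
         \<longlonglongrightarrow> 2 * norm xstar / real \<kappa> + c"
    if "\<And>x p. \<forall>i\<ge>1. x i = xstar \<Longrightarrow> 0 \<notin> set p \<Longrightarrow> length p \<le> \<kappa> \<Longrightarrow>
        dtd_recourse M \<xi> Q x p = c * real (length p)"
      and "\<And>x p. \<forall>i\<ge>1. x i = xstar \<Longrightarrow> 0 \<notin> set p \<Longrightarrow> length p \<le> \<kappa> \<Longrightarrow>
        or_recourse M \<xi> Q x p = c * real (length p)" for \<xi> c
    using loc by eventually_elim (intro opt_value_limit \<kappa> recourse_eq that; auto)
  have deterministic: "AE \<omega> in M. (\<lambda>n. opt_value \<pi> M \<xi> Q \<kappa> (\<lambda>i. X i \<omega>) n / real n)
         \<longlonglongrightarrow> \<alpha> * (2 * \<mu> * dbar / Q)"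
    if model: "demand_model M X \<xi> \<mu>" and const: "\<forall>i\<ge>1. AE \<omega> in M. \<xi> i \<omega> = \<mu>" for \<xi>
  proof -
    have "or_recourse M \<xi> Q x p = 0 * real (length p)" if "0 \<notin> set p" "length p \<le> \<kappa>" for x p
    proof -
      \<comment> \<open>The full load is the case \<open>m = 0\<close>; here every demand lowers the
        load by \<open>\<delta> = \<mu>\<close>.\<close>
      have "restock_cost M \<xi> Q x 0 p (Q - real 0 * \<mu>) = 0 * real (length p)"
      proof (rule restock_cost_linear[where \<kappa> = \<kappa>])
        fix i :: nat and G :: "real \<Rightarrow> real" and m :: nat and b :: real
        assume "i \<ge> 1" "m < \<kappa>" "G \<in> borel_measurable borel" "G (Q - real (Suc m) * \<mu>) = b"
        then show "serve_cost M \<xi> Q x i G (Q - real m * \<mu>) = b + 0"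
          unfolding add_0_right
          by (intro serve_cost_deterministic[OF assms(2) \<kappa>\<mu>] meas[OF model] const[rule_format])
      qed (use meas[OF model] that in simp_all)
      then show ?thesis by (simp add: or_recourse_def)
    qed
    moreover have "dtd_recourse M \<xi> Q x p = 0 * real (length p)" if "0 \<notin> set p" "length p \<le> \<kappa>" for x p
      using dtd_recourse_deterministic[OF assms(2) \<kappa>\<mu> meas[OF model] _ that] const by simp
    ultimately show ?thesis
      using limit[of \<xi> 0] unfolding rate by simp
  qed
  have bernoulli: "AE \<omega> in M. (\<lambda>n. opt_value \<pi> M \<xi> Q \<kappa> (\<lambda>i. X i \<omega>) n / real n)
         \<longlonglongrightarrow> \<alpha> * (2 * \<mu> * dbar / Q) + 2 * \<mu> * dbar / (Q + \<epsilon>)"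
    if \<epsilon>: "\<epsilon> \<in> {0<..Q / real \<kappa>}" and model: "demand_model M X \<xi> \<mu>"
      and distr: "\<forall>i\<ge>1. distr M borel (\<xi> i) =
         distr (measure_pmf (bernoulli_pmf (\<mu> / (Q + \<epsilon>)))) borel (\<lambda>b. (Q + \<epsilon>) * of_bool b)" for \<epsilon> \<xi>
  proof -
    define \<rho> where "\<rho> = \<mu> / (Q + \<epsilon>)"
    \<comment> \<open>The upper bound on \<open>\<epsilon>\<close> keeps the total drop in load over
      a route of \<open>\<kappa>\<close> customers within \<open>Q\<close>.\<close>
    have \<epsilon>: "\<epsilon> > 0" "real \<kappa> * \<epsilon> \<le> Q"
      using \<epsilon> \<kappa> by (simp_all add: le_divide_eq mult.commute)
    have \<rho>: "0 \<le> \<rho>" "\<rho> \<le> 1"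
      using assms(2,3) \<epsilon>(1) by (simp_all add: \<rho>_def divide_le_eq)
    have distr: "distr M borel (\<xi> i)
        = distr (measure_pmf (bernoulli_pmf \<rho>)) borel (\<lambda>b. (Q + \<epsilon>) * of_bool b)" if "i \<ge> 1" for i
      using distr that by (simp add: \<rho>_def)
    have "or_recourse M \<xi> Q x p = 2 * norm xstar * \<rho> * real (length p)"
      if x: "\<forall>i\<ge>1. x i = xstar" and p: "0 \<notin> set p" "length p \<le> \<kappa>" for x p
    proof -
      \<comment> \<open>Now \<open>\<delta> = \<epsilon>\<close>, and each customer costs one
        failure with probability \<open>\<rho>\<close>.\<close>
      have "restock_cost M \<xi> Q x 0 p (Q - real 0 * \<epsilon>) = 2 * norm xstar * \<rho> * real (length p)"
      proof (rule restock_cost_linear[where \<kappa> = \<kappa>])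
        fix i :: nat and G :: "real \<Rightarrow> real" and m :: nat and b :: real
        assume *: "i \<ge> 1" "m < \<kappa>" "G \<in> borel_measurable borel"
          "G (Q - real m * \<epsilon>) = b" "G (Q - real (Suc m) * \<epsilon>) = b"
        have "serve_cost M \<xi> Q x i G (Q - real m * \<epsilon>) = b + failure_cost x i * \<rho>"
          by (intro serve_cost_bernoulli[OF \<rho> Q \<epsilon>] meas[OF model] distr *)
        then show "serve_cost M \<xi> Q x i G (Q - real m * \<epsilon>) = b + 2 * norm xstar * \<rho>"
          unfolding failure_cost_def x[rule_format, OF *(1)] .
      qed (use meas[OF model] p in simp_all)
      then show ?thesis by (simp add: or_recourse_def)
    qed
    moreover have "dtd_recourse M \<xi> Q x p = 2 * norm xstar * \<rho> * real (length p)"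
      if x: "\<forall>i\<ge>1. x i = xstar" and p: "0 \<notin> set p" "length p \<le> \<kappa>" for x p
      using x by (intro dtd_recourse_bernoulli[OF \<rho> Q \<epsilon> meas[OF model] distr p]) (simp_all add: failure_cost_def)
    ultimately have "AE \<omega> in M. (\<lambda>n. opt_value \<pi> M \<xi> Q \<kappa> (\<lambda>i. X i \<omega>) n / real n)
         \<longlonglongrightarrow> 2 * norm xstar / real \<kappa> + 2 * norm xstar * \<rho>"
      by (intro limit) blast+
    moreover have "2 * norm xstar * \<rho> = 2 * \<mu> * dbar / (Q + \<epsilon>)"
      by (simp add: \<rho>_def dbar)
    ultimately show ?thesis by (simp only: rate)
  qed
  \<comment> \<open>\<open>Q > 0\<close> gives continuity at \<open>\<epsilon> = 0\<close>, where
    both terms share the factor \<open>2 * \<mu> * dbar / Q\<close>.\<close>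
  have "((\<lambda>\<epsilon>. \<alpha> * (2 * \<mu> * dbar / Q) + 2 * \<mu> * dbar / (Q + \<epsilon>))
      \<longlongrightarrow> \<alpha> * (2 * \<mu> * dbar / Q) + 2 * \<mu> * dbar / (Q + 0)) (at_right 0)"
    using Q by (intro tendsto_intros) auto
  then have "((\<lambda>\<epsilon>. \<alpha> * (2 * \<mu> * dbar / Q) + 2 * \<mu> * dbar / (Q + \<epsilon>))
      \<longlongrightarrow> (\<alpha> + 1) * (2 * \<mu> * dbar / Q)) (at_right 0)"
    unfolding distrib_right by simp
  then show ?thesis
    by (intro conjI ballI allI impI dbar) ((erule conjE, rule deterministic bernoulli; assumption) | assumption)+
qed

end
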